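(* Let $m\ge 3$ and $n\ge 1$ be integers. Then the Randić characteristic polynomial of the Dutch windmill graph $D_m^n$ satisfies $$RP(D_m^n,\lambda)=\Lambda_{m-1}^{\,n-1}\cdot RP(C_m,\lambda),$$ where $\Lambda_1=\lambda$, $\Lambda_2=\lambda^2-\tfrac14$, and $\Lambda_k=\lambda\Lambda_{k-1}-\tfrac14\Lambda_{k-2}$ for $k\ge 3$.
   Context: For a graph $G$ with vertices $v_1,\dots,v_N$ of degrees $d_1,\dots,d_N$, the Randić matrix $R(G)$ has $(i,j)$-entry $1/\sqrt{d_id_j}$ if $v_i\sim v_j$ and $0$ otherwise, and the Randić characteristic polynomial is $RP(G,\lambda)=\det(\lambda I-R(G))$. $C_m$ is the cycle on $m$ vertices. The Dutch windmill graph $D_m^n$ is the graph with $(m-1)n+1$ vertices and $mn$ edges obtained from $n$ disjoint copies of $C_m$ by identifying one vertex from each copy into a single common vertex. Equivalently, $\Lambda_k=\det(B_k)$ where $B_k$ is the $k\times k$ tridiagonal matrix with $\lambda$ on the diagonal and $-\tfrac12$ on the sub- and superdiagonals. *)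

theory Defs
  imports "Graph_Theory.Pair_Digraph" "Jordan_Normal_Form.Char_Poly"
begin

text \<open>
  Following \<^theory>\<open>Graph_Theory.Digraph\<close>, an undirected graph is a symmetric digraph: an edge
  is a pair of opposite arcs, so the degree of a vertex is its out-degree.
  The list \<open>vs\<close> is the enumeration \<open>v\<^sub>1, \<dots>, v\<^sub>N\<close> of the vertices of the graph.
\<close>

definition randic_matrix :: "('a, 'b) pre_digraph \<Rightarrow> 'a list \<Rightarrow> real mat" where
  "randic_matrix G vs = mat (length vs) (length vs) (\<lambda>(i, j).
     if vs ! i \<rightarrow>\<^bsub>G\<^esub> vs ! j
     then 1 / sqrt (real (out_degree G (vs ! i)) * real (out_degree G (vs ! j)))
     else 0)"

definition randic_poly :: "('a, 'b) pre_digraph \<Rightarrow> 'a list \<Rightarrow> real poly" where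
  "randic_poly G vs = char_poly (randic_matrix G vs)"

text \<open>This is the cycle \<open>C\<^sub>m\<close> only for \<open>m \<ge> 3\<close>.\<close>

definition cycle_graph :: "nat \<Rightarrow> nat pair_pre_digraph" where
  "cycle_graph m = \<lparr>
     pverts = {0..<m},
     parcs = {(u, v). u < m \<and> v < m \<and> (v = Suc u mod m \<or> u = Suc v mod m)} \<rparr>"

text \<open>
  The vertex \<open>u\<close> of the \<open>i\<close>-th disjoint copy of \<open>C\<^sub>m\<close> is \<open>(i, u)\<close>. The quotient map below
  identifies the vertices \<open>(i, 0)\<close> of all copies with the single vertex \<open>(0, 0)\<close>.
\<close>

fun glue :: "nat \<times> nat \<Rightarrow> nat \<times> nat" where
  "glue (i, u) = (if u = 0 then (0, 0) else (i, u))"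

definition dutch_windmill :: "nat \<Rightarrow> nat \<Rightarrow> (nat \<times> nat) pair_pre_digraph" where
  "dutch_windmill m n = \<lparr>
     pverts = glue ` ({0..<n} \<times> pverts (cycle_graph m)),
     parcs = {(glue (i, u), glue (i, v)) | i u v. i < n \<and> (u, v) \<in> parcs (cycle_graph m)} \<rparr>"

text \<open>
  The polynomials \<open>\<Lambda>\<^sub>k\<close> in the indeterminate \<open>\<lambda> = [:0, 1:]\<close>, meaningful for \<open>k \<ge> 1\<close>. The value
  at \<open>0\<close> only makes the function total; \<open>1\<close> is the empty determinant.
\<close>

fun Lambda_poly :: "nat \<Rightarrow> real poly" where
  "Lambda_poly 0 = 1"
| "Lambda_poly (Suc 0) = [:0, 1:]"
| "Lambda_poly (Suc (Suc 0)) = [:0, 1:]\<^sup>2 - [:1/4:]"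
| "Lambda_poly (Suc (Suc (Suc k))) =
     [:0, 1:] * Lambda_poly (Suc (Suc k)) - [:1/4:] * Lambda_poly (Suc k)"

lemma Suc_mod_eq: "u < m \<Longrightarrow> Suc u mod m = (if Suc u = m then 0 else Suc u)" by auto

lemma pair_graph_cycle_graph: assumes "m \<ge> 3" shows "pair_graph (cycle_graph m)"
proof -
  have "parcs (cycle_graph m) \<subseteq> {0..<m} \<times> {0..<m}" by (auto simp: cycle_graph_def)
  then have "finite (parcs (cycle_graph m))" by (rule finite_subset) simp
  then show ?thesis using assms
    by unfold_locales
      (auto simp: cycle_graph_def symmetric_def sym_def Suc_mod_eq split: if_splits)
qed

lemma pair_graph_dutch_windmill: assumes "m \<ge> 3" shows "pair_graph (dutch_windmill m n)"
proof -
  interpret C: pair_graph "cycle_graph m" by (rule pair_graph_cycle_graph[OF assms])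
  have "parcs (dutch_windmill m n)
      = (\<lambda>(i, u, v). (glue (i, u), glue (i, v))) ` ({0..<n} \<times> parcs (cycle_graph m))"
    by (force simp: dutch_windmill_def simp del: glue.simps)
  then have 1: "finite (parcs (dutch_windmill m n))" using C.pair_finite_arcs by simp
  have 2: "finite (pverts (dutch_windmill m n))" using C.pair_finite_verts by (simp add: dutch_windmill_def)
  have s: "(u,v) \<in> parcs (cycle_graph m) \<Longrightarrow> (v,u) \<in> parcs (cycle_graph m)" for u v
    by (auto simp: cycle_graph_def)
  show ?thesis
  proof unfold_locales
    show "symmetric (with_proj (dutch_windmill m n))"
      unfolding symmetric_def sym_def using s
      by (simp add: dutch_windmill_def del: glue.simps) blast
  next
    fix e assume "e \<in> parcs (dutch_windmill m n)"
    then obtain i u v where e: "e = (glue (i,u), glue (i,v))" "i < n" "(u,v) \<in> parcs (cycle_graph m)"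
      by (auto simp: dutch_windmill_def simp del: glue.simps)
    then have uv: "u \<in> pverts (cycle_graph m)" "v \<in> pverts (cycle_graph m)" "u \<noteq> v"
      using C.in_arcsD1 C.in_arcsD2 C.pair_no_loops by fastforce+
    show "fst e \<in> pverts (dutch_windmill m n)" "snd e \<in> pverts (dutch_windmill m n)"
      using e uv by (auto simp: dutch_windmill_def simp del: glue.simps)
    show "fst e \<noteq> snd e" using e uv by (auto split: if_splits)
  qed (use 1 2 in auto)
qed

lemma card_pverts_dutch_windmill:
  assumes "m \<ge> 3" "n \<ge> 1" shows "card (pverts (dutch_windmill m n)) = (m - 1) * n + 1"
proof -
  have "pverts (dutch_windmill m n) = insert (0,0) ({0..<n} \<times> {1..<m})"
  proof (intro equalityI subsetI)
    fix x assume "x \<in> insert (0,0) ({0..<n} \<times> {1..<m})"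
    then have "x = glue x \<and> x \<in> {0..<n} \<times> {0..<m}"
      using assms by (cases x) auto
    then show "x \<in> pverts (dutch_windmill m n)"
      by (force simp: dutch_windmill_def cycle_graph_def simp del: glue.simps)
  qed (auto simp: dutch_windmill_def cycle_graph_def split: if_splits)
  then show ?thesis by (simp add: card_insert_if mult.commute)
qed

lemma card_parcs_cycle_graph: assumes "m \<ge> 3" shows "card (parcs (cycle_graph m)) = 2 * m"
proof -
  let ?A = "(\<lambda>u. (u, Suc u mod m)) ` {0..<m}" and ?B = "(\<lambda>u. (Suc u mod m, u)) ` {0..<m}"
  have "parcs (cycle_graph m) = ?A \<union> ?B" using assms by (auto simp: cycle_graph_def)
  moreover have "?A \<inter> ?B = {}" using assms by (auto simp: Suc_mod_eq split: if_splits)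
  ultimately show ?thesis by (simp add: card_Un_disjoint card_image inj_on_def)
qed

lemma card_parcs_dutch_windmill:
  assumes "m \<ge> 3" shows "card (parcs (dutch_windmill m n)) = 2 * (m * n)"
proof -
  interpret C: pair_graph "cycle_graph m" by (rule pair_graph_cycle_graph[OF assms])
  let ?f = "\<lambda>(i, u, v). (glue (i, u), glue (i, v))"
  have "parcs (dutch_windmill m n) = ?f ` ({0..<n} \<times> parcs (cycle_graph m))"
    by (force simp: dutch_windmill_def simp del: glue.simps)
  moreover have "inj_on ?f ({0..<n} \<times> parcs (cycle_graph m))"
    using C.pair_no_loops by (fastforce simp: inj_on_def split: if_splits)
  ultimately show ?thesis
    using card_parcs_cycle_graph[OF assms] by (simp add: card_image)
qed

end

theory Submission
  imports Defs
begin

text \<open>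
  Let \<open>P\<close> add to each petal \<open>i \<ge> 1\<close> the values of petal \<open>0\<close> and scale the hub by \<open>\<surd>n\<close>. Then
  \<open>R(D) P = P T\<close>, where \<open>T\<close> is block upper triangular: its first diagonal block, on the
  hub and petal \<open>0\<close>, is \<open>R(C\<^sub>m)\<close> (the factor \<open>\<surd>n\<close> turns the weights \<open>1 / \<surd>(4 n)\<close> at the hub
  into \<open>1 / 2\<close>), and each of the other \<open>n - 1\<close> blocks is half the adjacency matrix of the path on
  \<open>m - 1\<close> vertices, with characteristic polynomial \<open>\<Lambda>\<close>.
\<close>

section \<open>Matrices with rows and columns indexed by lists of labels\<close>

text \<open>Entries depend on labels rather than positions, so vertices serve as indices directly,
  blocks become appended lists, and reordering the vertices changes only the lists.\<close>

definition list_mat :: "('a \<Rightarrow> 'b \<Rightarrow> 'c) \<Rightarrow> 'a list \<Rightarrow> 'b list \<Rightarrow> 'c mat" where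
  "list_mat f xs ys = mat (length xs) (length ys) (\<lambda>(i, j). f (xs ! i) (ys ! j))"

lemma list_mat_carrier [simp]: "list_mat f xs ys \<in> carrier_mat (length xs) (length ys)"
  by (simp add: list_mat_def)

lemma list_mat_dim [simp]:
  "dim_row (list_mat f xs ys) = length xs" "dim_col (list_mat f xs ys) = length ys"
  by (simp_all add: list_mat_def)

lemma list_mat_index [simp]:
  "i < length xs \<Longrightarrow> j < length ys \<Longrightarrow> list_mat f xs ys $$ (i, j) = f (xs ! i) (ys ! j)"
  by (simp add: list_mat_def)

lemma list_mat_cong:
  assumes "\<And>x y. x \<in> set xs \<Longrightarrow> y \<in> set ys \<Longrightarrow> f x y = g x y"
  shows "list_mat f xs ys = list_mat g xs ys"
  using assms by (auto intro!: eq_matI)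

lemma list_mat_map: "list_mat f (map g xs) (map h ys) = list_mat (\<lambda>x y. f (g x) (h y)) xs ys"
  by (auto intro!: eq_matI)

lemma list_mat_delta:
  "distinct xs \<Longrightarrow> list_mat (\<lambda>x y. if x = y then 1 else 0) xs xs = 1\<^sub>m (length xs)"
  by (auto intro!: eq_matI simp: nth_eq_iff_index_eq)

text \<open>Distinctness makes positions in \<open>ys\<close> correspond bijectively to labels, so
  products turn into sums over sets, in which the order of the labels no longer matters.\<close>

lemma list_mat_mult:
  assumes "distinct ys"
  shows "list_mat f xs ys * list_mat g ys zs = list_mat (\<lambda>x z. \<Sum>y\<in>set ys. f x y * g y z) xs zs"
proof (rule eq_matI)
  fix i k
  assume "i < dim_row (list_mat (\<lambda>x z. \<Sum>y\<in>set ys. f x y * g y z) xs zs)"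
    "k < dim_col (list_mat (\<lambda>x z. \<Sum>y\<in>set ys. f x y * g y z) xs zs)"
  then have ik: "i < length xs" "k < length zs" by simp_all
  have "(\<Sum>j\<in>{0..<length ys}. f (xs ! i) (ys ! j) * g (ys ! j) (zs ! k))
      = (\<Sum>y\<in>set ys. f (xs ! i) y * g y (zs ! k))"
    by (rule sum.reindex_bij_betw[of "\<lambda>j. ys ! j"])
      (use bij_betw_nth[OF assms] in \<open>auto simp: atLeast0LessThan\<close>)
  then show "(list_mat f xs ys * list_mat g ys zs) $$ (i, k)
      = list_mat (\<lambda>x z. \<Sum>y\<in>set ys. f x y * g y z) xs zs $$ (i, k)"
    using ik by (simp add: scalar_prod_def)
qed simp_all

lemma list_mat_append:
  "list_mat f (xs @ ys) (xs @ ys) = four_block_mat (list_mat f xs xs) (list_mat f xs ys)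
     (list_mat f ys xs) (list_mat f ys ys)"
  by (rule eq_matI) (auto simp: nth_append)

section \<open>Characteristic polynomials under similarity and block triangular form\<close>

lemma char_poly_matrix_list_mat:
  assumes "distinct xs"
  shows "char_poly_matrix (list_mat f xs xs)
       = list_mat (\<lambda>x y. (if x = y then [:0, 1:] else 0) - [:f x y:]) xs xs"
  using assms by (auto intro!: eq_matI simp: char_poly_matrix_def nth_eq_iff_index_eq)

text \<open>The relations \<open>P Q = 1\<close> and \<open>f P = P g\<close> give
  \<open>f = P g Q\<close>. Since the rows of \<open>P\<close> follow \<open>xs\<close> and its
  columns follow \<open>ys\<close>, one similarity covers both a change of basis and a change of
  enumeration.\<close>

lemma char_poly_list_mat_similar:
  fixes f :: "'a \<Rightarrow> 'a \<Rightarrow> 'c :: field"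
  assumes "distinct xs" "distinct ys" and s: "set xs = set ys"
    and PQ: "\<And>x z. x \<in> set ys \<Longrightarrow> z \<in> set ys \<Longrightarrow>
      (\<Sum>y\<in>set ys. P x y * Q y z) = (if x = z then 1 else 0)"
    and comm: "\<And>x z. x \<in> set ys \<Longrightarrow> z \<in> set ys \<Longrightarrow>
      (\<Sum>y\<in>set ys. f x y * P y z) = (\<Sum>y\<in>set ys. P x y * g y z)"
  shows "char_poly (list_mat f xs xs) = char_poly (list_mat g ys ys)"
proof -
  let ?P = "list_mat P xs ys" and ?Q = "list_mat Q ys xs"
  let ?F = "list_mat f xs xs" and ?G = "list_mat g ys ys"
  have len: "length xs = length ys" using distinct_card[OF assms(1)] distinct_card[OF assms(2)] s by simp
  have c: "?F \<in> carrier_mat (length ys) (length ys)" "?G \<in> carrier_mat (length ys) (length ys)"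
    "?P \<in> carrier_mat (length ys) (length ys)" "?Q \<in> carrier_mat (length ys) (length ys)"
    by (intro carrier_matI; simp add: len)+
  have "?P * ?Q = list_mat (\<lambda>x y. if x = y then 1 else 0) xs xs"
    unfolding list_mat_mult[OF assms(2)] by (rule list_mat_cong) (simp add: PQ s)
  then have 1: "?P * ?Q = 1\<^sub>m (length ys)" using assms(1) len by (simp add: list_mat_delta)
  \<comment> \<open>For square matrices over a field a one-sided inverse is two-sided.\<close>
  have 2: "?Q * ?P = 1\<^sub>m (length ys)" by (rule mat_mult_left_right_inverse[OF c(3,4) 1])
  have "?F * ?P = ?P * ?G"
    unfolding list_mat_mult[OF assms(1)] list_mat_mult[OF assms(2)]
    by (rule list_mat_cong) (simp add: comm s)
  then have "?P * ?G * ?Q = ?F * (?P * ?Q)" using assoc_mult_mat[OF c(1,3,4)] by (simp only:)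
  also have "\<dots> = ?F" unfolding 1 using c(1) by (rule right_mult_one_mat)
  finally have "?F = ?P * ?G * ?Q" by (rule sym)
  with c have "similar_mat ?F ?G" by (intro similar_matI[OF _ 1 2]) blast+
  then show ?thesis by (rule char_poly_similar)
qed

text \<open>The identity kernel, with rows listed by \<open>xs\<close> and columns by
  \<open>ys\<close>, is a permutation matrix that conjugates one matrix into the other.\<close>

lemma char_poly_list_mat_reorder:
  fixes f :: "'a \<Rightarrow> 'a \<Rightarrow> 'c :: field"
  assumes "distinct xs" "distinct ys" "set xs = set ys"
  shows "char_poly (list_mat f xs xs) = char_poly (list_mat f ys ys)"
proof (rule char_poly_list_mat_similar[OF assms])
  let ?I = "\<lambda>x y. of_bool (x = y) :: 'c"
  fix x z assume "x \<in> set ys" "z \<in> set ys"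
  then have i: "set ys \<inter> {y. x = y} = {x}" "set ys \<inter> {y. y = z} = {z}" by blast+
  show "(\<Sum>y\<in>set ys. ?I x y * ?I y z) = (if x = z then 1 else 0)"
    by (subst sum_of_bool_mult_eq, simp, unfold i, simp)
  show "(\<Sum>y\<in>set ys. f x y * ?I y z) = (\<Sum>y\<in>set ys. ?I x y * f y z)"
    by (subst sum_of_bool_mult_eq, simp, subst sum_mult_of_bool_eq, simp, unfold i, simp)
qed

text \<open>The matrix is block upper triangular. As \<open>xs\<close> and \<open>ys\<close> share
  no label, subtracting it from the indeterminate times the identity keeps the lower left block
  zero.\<close>

lemma char_poly_list_mat_append:
  fixes f :: "'a \<Rightarrow> 'a \<Rightarrow> 'c :: idom"
  assumes "distinct (xs @ ys)" and "\<And>x y. x \<in> set xs \<Longrightarrow> y \<in> set ys \<Longrightarrow> f y x = 0"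
  shows "char_poly (list_mat f (xs @ ys) (xs @ ys))
       = char_poly (list_mat f xs xs) * char_poly (list_mat f ys ys)"
proof -
  let ?h = "\<lambda>x y. (if x = y then [:0, 1:] else 0) - [:f x y:]"
  have d: "distinct xs" "distinct ys" using assms(1) by simp_all
  have "list_mat ?h ys xs = 0\<^sub>m (length ys) (length xs)"
  proof (rule eq_matI)
    fix i j assume "i < dim_row (0\<^sub>m (length ys) (length xs) :: 'c poly mat)"
      "j < dim_col (0\<^sub>m (length ys) (length xs) :: 'c poly mat)"
    then have ij: "i < length ys" "j < length xs" by simp_all
    then have "ys ! i \<in> set ys" "xs ! j \<in> set xs" by simp_all
    moreover from this have "ys ! i \<noteq> xs ! j" using assms(1) by auto
    ultimately show "list_mat ?h ys xs $$ (i, j) = 0\<^sub>m (length ys) (length xs) $$ (i, j)"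
      using ij assms(2) by simp
  qed simp_all
  then show ?thesis
    unfolding char_poly_def char_poly_matrix_list_mat[OF assms(1)] char_poly_matrix_list_mat[OF d(1)]
      char_poly_matrix_list_mat[OF d(2)]
    unfolding list_mat_append
    by (rule det_four_block_mat_lower_left_zero[OF list_mat_carrier list_mat_carrier _ list_mat_carrier])
qed

lemma char_poly_list_mat_concat:
  fixes f :: "'a \<Rightarrow> 'a \<Rightarrow> 'c :: idom"
  assumes "distinct (concat xss)"
    and "sorted_wrt (\<lambda>xs ys. \<forall>x\<in>set xs. \<forall>y\<in>set ys. f y x = 0) xss"
  shows "char_poly (list_mat f (concat xss) (concat xss))
       = (\<Prod>xs\<leftarrow>xss. char_poly (list_mat f xs xs))"
  using assms
proof (induction xss)
  case Nil
  have "char_poly_matrix (list_mat f [] []) = 1\<^sub>m 0" by (rule eq_matI) (auto simp: char_poly_matrix_def)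
  then show ?case by (simp add: char_poly_def)
next
  case (Cons xs xss)
  have "char_poly (list_mat f (xs @ concat xss) (xs @ concat xss))
      = char_poly (list_mat f xs xs) * char_poly (list_mat f (concat xss) (concat xss))"
    using Cons.prems by (intro char_poly_list_mat_append) auto
  then show ?case using Cons by simp
qed

section \<open>Tridiagonal determinants and the polynomials \<open>Lambda_poly\<close>\<close>

text \<open>This is the continuant recurrence: \<open>a\<close> interacts only with itself and
  \<open>b\<close>, so expanding along the first row leaves two minors, and the second reduces by
  its first column.\<close>

lemma det_list_mat_tridiagonal:
  fixes q :: "'a \<Rightarrow> 'a \<Rightarrow> 'c :: idom"
  assumes "\<And>x. x \<in> set xs \<Longrightarrow> q a x = 0" "\<And>x. x \<in> set xs \<Longrightarrow> q x a = 0"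
  shows "det (list_mat q (a # b # xs) (a # b # xs))
       = q a a * det (list_mat q (b # xs) (b # xs)) - q a b * q b a * det (list_mat q xs xs)"
proof -
  let ?A = "list_mat q (a # b # xs) (a # b # xs)"
  let ?B = "list_mat q (b # xs) (a # xs)"
  have nz: "q a (xs ! i) = 0" "q (xs ! i) a = 0" if "i < length xs" for i
    using assms nth_mem[OF that] by blast+
  have A: "?A \<in> carrier_mat (Suc (Suc (length xs))) (Suc (Suc (length xs)))"
    by (intro carrier_matI) simp_all
  have B: "?B \<in> carrier_mat (Suc (length xs)) (Suc (length xs))"
    by (intro carrier_matI) simp_all
  have d0: "mat_delete ?A 0 0 = list_mat q (b # xs) (b # xs)"
    by (rule eq_matI) (auto simp: mat_delete_def)
  have d1: "mat_delete ?A 0 1 = ?B"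
    by (rule eq_matI) (auto simp: mat_delete_def nth_Cons')
  have d2: "mat_delete ?B 0 0 = list_mat q xs xs"
    by (rule eq_matI) (auto simp: mat_delete_def)
  \<comment> \<open>Column \<open>a\<close> of \<open>?B\<close> has \<open>q b a\<close> in its top
    row and zeros below.\<close>
  have "det ?B = (\<Sum>i<Suc (length xs). ?B $$ (i, 0) * cofactor ?B i 0)"
    by (rule laplace_expansion_column[OF B]) simp
  also have "\<dots> = q b a * det (list_mat q xs xs)"
    unfolding sum.lessThan_Suc_shift using nz by (simp add: cofactor_def d2)
  finally have detB: "det ?B = q b a * det (list_mat q xs xs)" .
  have "det ?A = (\<Sum>j<Suc (Suc (length xs)). ?A $$ (0, j) * cofactor ?A 0 j)"
    by (rule laplace_expansion_row[OF A]) simp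
  also have "\<dots> = q a a * det (list_mat q (b # xs) (b # xs)) - q a b * det ?B"
    unfolding sum.lessThan_Suc_shift using nz d1 by (simp add: cofactor_def d0)
  finally show ?thesis by (simp add: detB)
qed

text \<open>The value 1 at index 0 makes the equation for \<open>Lambda_poly 2\<close> an instance
  of the general recurrence, so the induction needs no separate case.\<close>

lemma Lambda_poly_rec:
  "Lambda_poly (Suc (Suc k)) = [:0, 1:] * Lambda_poly (Suc k) - [:1/4:] * Lambda_poly k"
  by (cases k) (simp_all add: power2_eq_square)

text \<open>Removing the first one or two vertices of a path leaves a path with a shifted start. The
  offset \<open>a\<close> is therefore arbitrary in the induction.\<close>

lemma char_poly_path:
  "char_poly (list_mat (\<lambda>x y. if y = Suc x \<or> x = Suc y then 1/2 else (0::real))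
     [a..<a + k] [a..<a + k]) = Lambda_poly k"
proof -
  define q :: "nat \<Rightarrow> nat \<Rightarrow> real poly" where "q x y = (if x = y then [:0, 1:] else 0)
    - [:if y = Suc x \<or> x = Suc y then 1/2 else 0:]" for x y
  have "det (list_mat q [a..<a + k] [a..<a + k]) = Lambda_poly k"
  proof (induction k arbitrary: a rule: induct_nat_012)
    case 0
    have "list_mat q [] [] = 1\<^sub>m 0" by (rule eq_matI) auto
    then show ?case by simp
  next
    case 1
    show ?case by (simp add: det_single q_def list_mat_def)
  next
    case (ge2 k)
    have u: "[a..<a + Suc (Suc k)] = a # Suc a # [Suc (Suc a)..<Suc (Suc a) + k]"
      "[Suc a..<Suc a + Suc k] = Suc a # [Suc (Suc a)..<Suc (Suc a) + k]"
      by (simp_all add: upt_rec)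
    have "det (list_mat q [a..<a + Suc (Suc k)] [a..<a + Suc (Suc k)])
        = q a a * Lambda_poly (Suc k) - q a (Suc a) * q (Suc a) a * Lambda_poly k"
      \<comment> \<open>The induction hypotheses are used backwards, to turn both
        \<open>Lambda_poly\<close> values into the minors of the continuant recurrence.\<close>
      unfolding u(1) ge2(1)[of "Suc (Suc a)", symmetric] ge2(2)[of "Suc a", symmetric, unfolded u(2)]
      by (rule det_list_mat_tridiagonal) (auto simp: q_def)
    also have "q a a = [:0, 1:]" by (simp add: q_def)
    also have "q a (Suc a) * q (Suc a) a = [:1/4:]" by (simp add: q_def)
    finally show ?case by (simp only: Lambda_poly_rec)
  qed
  then show ?thesis
    unfolding char_poly_def q_def by (simp add: char_poly_matrix_list_mat)
qed

section \<open>Adjacency and degrees in the cycle and the windmill\<close>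

lemma cycle_arc_iff:
  assumes "m \<ge> 3"
  shows "(u, v) \<in> parcs (cycle_graph m) \<longleftrightarrow> u < m \<and> v < m \<and>
    (v = Suc u \<or> u = Suc v \<or> (Suc u = m \<and> v = 0) \<or> (Suc v = m \<and> u = 0))"
  using assms by (auto simp: cycle_graph_def Suc_mod_eq split: if_splits)

lemma card_cycle_neighbours:
  assumes "m \<ge> 3" "u < m"
  shows "card {v. (u, v) \<in> parcs (cycle_graph m)} = 2"
proof -
  have "{v. (u, v) \<in> parcs (cycle_graph m)} = {if Suc u = m then 0 else Suc u, if u = 0 then m - 1 else u - 1}"
    using assms by (auto simp: cycle_arc_iff split: if_splits)
  then show ?thesis using assms by auto
qed

lemma out_degree_with_proj: "out_degree (with_proj G) x = card {y. (x, y) \<in> parcs G}"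
proof -
  have "out_arcs (with_proj G) x = Pair x ` {y. (x, y) \<in> parcs G}"
    by (auto simp: out_arcs_def image_iff)
  then show ?thesis by (simp add: out_degree_def card_image inj_on_def)
qed

lemma verts_dutch_windmill:
  assumes "m \<ge> 3" "n \<ge> 1"
  shows "pverts (dutch_windmill m n) = insert (0, 0) ({0..<n} \<times> {1..<m})"
proof (intro equalityI subsetI)
  fix x assume "x \<in> insert (0,0) ({0..<n} \<times> {1..<m})"
  then have "x = glue x \<and> x \<in> {0..<n} \<times> {0..<m}"
    using assms by (cases x) auto
  then show "x \<in> pverts (dutch_windmill m n)"
    by (force simp: dutch_windmill_def cycle_graph_def simp del: glue.simps)
qed (auto simp: dutch_windmill_def cycle_graph_def split: if_splits)

text \<open>The hub carries the conventional petal index 0 but lies on every petal, so the indices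
  must agree only when neither end is the hub.\<close>

lemma windmill_arc_iff:
  assumes "m \<ge> 3"
    and "(j, v) \<in> insert (0, 0) ({0..<n} \<times> {1..<m})" "(i, u) \<in> insert (0, 0) ({0..<n} \<times> {1..<m})"
  shows "((j, v), (i, u)) \<in> parcs (dutch_windmill m n)
    \<longleftrightarrow> (v, u) \<in> parcs (cycle_graph m) \<and> (v = 0 \<or> u = 0 \<or> i = j)"
proof -
  have nl: "(0, 0) \<notin> parcs (cycle_graph m)" using assms(1) by (simp add: cycle_arc_iff)
  show ?thesis
  proof
    assume "((j, v), (i, u)) \<in> parcs (dutch_windmill m n)"
    then show "(v, u) \<in> parcs (cycle_graph m) \<and> (v = 0 \<or> u = 0 \<or> i = j)"
      by (auto simp: dutch_windmill_def split: if_splits)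
  next
    assume h: "(v, u) \<in> parcs (cycle_graph m) \<and> (v = 0 \<or> u = 0 \<or> i = j)"
    \<comment> \<open>The copy containing the arc is that of an end other than the hub. Such an end
      exists because the cycle has no loop at 0.\<close>
    define k where "k = (if v = 0 then i else j)"
    have "k < n" "(j, v) = glue (k, v)" "(i, u) = glue (k, u)"
      using h nl assms(2,3) by (auto simp: k_def)
    then show "((j, v), (i, u)) \<in> parcs (dutch_windmill m n)"
      unfolding dutch_windmill_def using h by (simp del: glue.simps) blast
  qed
qed

lemma out_degree_dutch_windmill:
  assumes "m \<ge> 3" "n \<ge> 1" "(j, v) \<in> insert (0, 0) ({0..<n} \<times> {1..<m})"
  shows "out_degree (with_proj (dutch_windmill m n)) (j, v) = (if v = 0 then 2 * n else 2)"
proof -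
  let ?V = "insert (0, 0) ({0..<n} \<times> {1..<m})"
  let ?C = "\<lambda>v. {u. (v, u) \<in> parcs (cycle_graph m)}"
  interpret D: pair_graph "dutch_windmill m n" by (rule pair_graph_dutch_windmill[OF assms(1)])
  have "y \<in> ?V" if "((j, v), y) \<in> parcs (dutch_windmill m n)" for y
    using D.in_arcsD2[OF that] by (simp only: verts_dutch_windmill[OF assms(1,2)])
  then have eq: "{y. ((j, v), y) \<in> parcs (dutch_windmill m n)}
      = {(i, u). (i, u) \<in> ?V \<and> u \<in> ?C v \<and> (v = 0 \<or> u = 0 \<or> i = j)}"
    using windmill_arc_iff[OF assms(1,3)] by blast
  have C: "u < m" if "u \<in> ?C v" for u v
    using that assms(1) by (auto simp: cycle_arc_iff)
  show ?thesis
  proof (cases "v = 0")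
    case True
    \<comment> \<open>Neighbours of the hub: two in each of the \<open>n\<close> petals.\<close>
    have "{y. ((j, v), y) \<in> parcs (dutch_windmill m n)} = {0..<n} \<times> ?C 0"
      unfolding eq using True assms(1) by (auto simp: cycle_arc_iff)
    then show ?thesis using True assms(1)
      by (simp add: out_degree_with_proj card_cartesian_product card_cycle_neighbours)
  next
    case False
    \<comment> \<open>Away from the hub the neighbours are those in the cycle, with 0 renamed to the
      hub.\<close>
    have "{y. ((j, v), y) \<in> parcs (dutch_windmill m n)} = (\<lambda>u. if u = 0 then (0, 0) else (j, u)) ` ?C v"
      unfolding eq using False assms(3) C by (auto simp: image_iff)
    moreover have "inj_on (\<lambda>u. if u = 0 then (0, 0) else (j, u)) (?C v)"
      by (auto simp: inj_on_def split: if_splits)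
    moreover have "card (?C v) = 2" using assms by (intro card_cycle_neighbours) auto
    ultimately show ?thesis using False by (simp only: out_degree_with_proj card_image if_False)
  qed
qed

section \<open>Randic matrices and the change of basis\<close>

definition cycle_entry :: "nat \<Rightarrow> nat \<Rightarrow> nat \<Rightarrow> real" where
  "cycle_entry m v u = (if (v, u) \<in> parcs (cycle_graph m) then 1 / 2 else 0)"

lemma cycle_entry_0_0: "m \<ge> 3 \<Longrightarrow> cycle_entry m 0 0 = 0"
  by (simp add: cycle_entry_def cycle_arc_iff)

definition windmill_entry :: "nat \<Rightarrow> nat \<Rightarrow> nat \<times> nat \<Rightarrow> nat \<times> nat \<Rightarrow> real" where
  "windmill_entry m n x y =
     (if snd x = 0 \<or> snd y = 0 then cycle_entry m (snd x) (snd y) / sqrt n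
      else if fst x = fst y then cycle_entry m (snd x) (snd y) else 0)"

text \<open>This is the matrix \<open>T\<close>. The hub \<open>(0, 0)\<close> shares its first
  coordinate with petal 0, so together they form a full cycle block. The division by
  \<open>n\<close> is forced by commutation with \<open>merge\<close>; these entries lie above the
  diagonal blocks.\<close>

definition split_entry :: "nat \<Rightarrow> nat \<Rightarrow> nat \<times> nat \<Rightarrow> nat \<times> nat \<Rightarrow> real" where
  "split_entry m n x y =
     (if fst x = fst y then cycle_entry m (snd x) (snd y)
      else if snd x = 0 then cycle_entry m (snd x) (snd y) / n else 0)"

text \<open>This is the matrix \<open>P\<close>. Its column at \<open>(0, u)\<close> with
  \<open>u\<close> nonzero is the indicator of vertex \<open>u\<close> in all petals; columns of
  later petals are unit vectors.\<close>

definition merge :: "nat \<Rightarrow> nat \<times> nat \<Rightarrow> nat \<times> nat \<Rightarrow> real" where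
  "merge n x y = (if snd x = snd y \<and> (fst x = fst y \<or> fst y = 0)
     then (if snd y = 0 then sqrt n else 1) else 0)"

text \<open>The inverse of \<open>merge\<close> on the vertex set: it subtracts petal 0 from every
  other petal and rescales the hub by \<open>1 / sqrt n\<close>.\<close>

definition unmerge :: "nat \<Rightarrow> nat \<times> nat \<Rightarrow> nat \<times> nat \<Rightarrow> real" where
  "unmerge n x y = (if snd x = snd y
     then if fst x = fst y then (if snd y = 0 then 1 / sqrt n else 1)
       else if fst y = 0 then - 1 else 0
     else 0)"

lemma randic_matrix_cycle:
  assumes "m \<ge> 3" "set ws = pverts (cycle_graph m)"
  shows "randic_matrix (with_proj (cycle_graph m)) ws = list_mat (cycle_entry m) ws ws"
proof -
  have "out_degree (with_proj (cycle_graph m)) u = 2" if "u \<in> set ws" for u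
  proof -
    have "u < m" using that assms(2) by (simp add: cycle_graph_def)
    then show ?thesis using assms(1) by (simp only: out_degree_with_proj card_cycle_neighbours)
  qed
  then show ?thesis
    unfolding randic_matrix_def list_mat_def by (intro cong_mat) (auto simp: cycle_entry_def)
qed

lemma randic_matrix_windmill:
  assumes "m \<ge> 3" "n \<ge> 1" "set vs = pverts (dutch_windmill m n)"
  shows "randic_matrix (with_proj (dutch_windmill m n)) vs = list_mat (windmill_entry m n) vs vs"
proof -
  let ?D = "with_proj (dutch_windmill m n)"
  have e: "(if x \<rightarrow>\<^bsub>?D\<^esub> y then 1 / sqrt (real (out_degree ?D x) * real (out_degree ?D y)) else 0)
      = windmill_entry m n x y" if "x \<in> set vs" "y \<in> set vs" for x y
  proof -
    obtain j v i u where xy: "x = (j, v)" "y = (i, u)" by fastforce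
    have mem: "(j, v) \<in> insert (0, 0) ({0..<n} \<times> {1..<m})" "(i, u) \<in> insert (0, 0) ({0..<n} \<times> {1..<m})"
      using that assms by (simp_all only: verts_dutch_windmill xy)
    \<comment> \<open>A hub of degree \<open>2 * n\<close> next to a vertex of degree 2 gives the
      entry \<open>1 / (2 * sqrt n)\<close>.\<close>
    have 4: "sqrt (2 * real n * 2) = 2 * sqrt n" "sqrt (2 * (2 * real n)) = 2 * sqrt n"
      using real_sqrt_mult[of 4 "real n"] by (simp_all add: mult.commute)
    have nl: "(0, 0) \<notin> parcs (cycle_graph m)" using assms(1) by (simp add: cycle_arc_iff)
    show ?thesis
      unfolding xy with_proj_simps windmill_arc_iff[OF assms(1) mem]
        out_degree_dutch_windmill[OF assms(1,2) mem(1)] out_degree_dutch_windmill[OF assms(1,2) mem(2)]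
      using nl 4 by (auto simp: windmill_entry_def cycle_entry_def)
  qed
  then show ?thesis
    unfolding randic_matrix_def list_mat_def by (intro cong_mat) (auto simp del: with_proj_simps)
qed

text \<open>Row \<open>(j, v)\<close> of \<open>merge\<close> is supported on \<open>(j, v)\<close>
  and \<open>(0, v)\<close>, which coincide at the hub and on petal 0.\<close>

lemma sum_merge_row:
  assumes V: "V = insert (0, 0) ({0..<n} \<times> {1..<m})" "(j, v) \<in> V"
  shows "(\<Sum>y\<in>V. merge n (j, v) y * g y)
    = (if v = 0 then sqrt n * g (0, 0) else if j = 0 then g (0, v) else g (j, v) + g (0, v))"
proof -
  have "(\<Sum>y\<in>V. merge n (j, v) y * g y) = (\<Sum>y\<in>{(j, v), (0, v)}. merge n (j, v) y * g y)"
    using V by (intro sum.mono_neutral_right) (auto simp: merge_def)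
  then show ?thesis using V by (auto simp: merge_def)
qed

lemma sum_merge_col:
  assumes V: "V = insert (0, 0) ({0..<n} \<times> {1..<m})" "(i, u) \<in> V"
  shows "(\<Sum>y\<in>V. g y * merge n y (i, u))
    = (if u = 0 then g (0, 0) * sqrt n else if i = 0 then \<Sum>j<n. g (j, u) else g (i, u))"
proof -
  let ?S = "if u = 0 then {(0, 0)} else if i = 0 then (\<lambda>j. (j, u)) ` {..<n} else {(i, u)}"
  have "(\<Sum>y\<in>V. g y * merge n y (i, u)) = (\<Sum>y\<in>?S. g y * merge n y (i, u))"
    using V by (intro sum.mono_neutral_right) (auto simp: merge_def)
  then show ?thesis using V by (auto simp: merge_def sum.reindex inj_on_def)
qed

lemma char_poly_windmill_split:
  assumes "m \<ge> 3" "n \<ge> 1" "distinct vs" "distinct L"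
    and V: "set vs = insert (0, 0) ({0..<n} \<times> {1..<m})" "set L = set vs"
  shows "char_poly (list_mat (windmill_entry m n) vs vs) = char_poly (list_mat (split_entry m n) L L)"
proof (rule char_poly_list_mat_similar[where P = "merge n" and Q = "unmerge n"])
  have L: "set L = insert (0, 0) ({0..<n} \<times> {1..<m})" using V by simp
  \<comment> \<open>These identities settle the hub row: the first for columns in petal 0, where
    \<open>n\<close> equal entries add up, the second for columns in later petals.\<close>
  have n: "real n * c / sqrt n = sqrt n * c" "sqrt n * c / real n = c / sqrt n" "sqrt n > 0" for c
    using assms(2) by (simp_all add: field_simps)
  fix x z assume xz: "x \<in> set L" "z \<in> set L"
  obtain j v i u where xz': "x = (j, v)" "z = (i, u)" by fastforce
  have mem: "(j, v) \<in> set L" "(i, u) \<in> set L" using xz xz' by simp_all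
  have range: "v = 0 \<and> j = 0 \<or> v \<noteq> 0 \<and> j < n" "u = 0 \<and> i = 0 \<or> u \<noteq> 0 \<and> i < n"
    using mem unfolding L by auto
  show "(\<Sum>y\<in>set L. merge n x y * unmerge n y z) = (if x = z then 1 else 0)"
    unfolding xz' sum_merge_row[OF L mem(1)] using range n(3) by (auto simp: unmerge_def)
  show "(\<Sum>y\<in>set L. windmill_entry m n x y * merge n y z)
      = (\<Sum>y\<in>set L. merge n x y * split_entry m n y z)"
    unfolding xz' sum_merge_row[OF L mem(1)] sum_merge_col[OF L mem(2)]
    using range n cycle_entry_0_0[OF assms(1)]
    by (auto simp: windmill_entry_def split_entry_def)
qed (use assms in auto)

section \<open>Splitting the windmill into one cycle and \<open>n - 1\<close> paths\<close>

theorem theorem3p1: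
  fixes m n :: nat and vs :: "(nat \<times> nat) list" and ws :: "nat list"
  assumes "m \<ge> 3" and "n \<ge> 1"
    and "distinct vs" and "set vs = verts (with_proj (dutch_windmill m n))"
    and "distinct ws" and "set ws = verts (with_proj (cycle_graph m))"
  shows "randic_poly (with_proj (dutch_windmill m n)) vs
       = Lambda_poly (m - 1) ^ (n - 1) * randic_poly (with_proj (cycle_graph m)) ws"
proof -
  \<comment> \<open>Petal 0 is left out here; it heads \<open>L\<close> together with the hub, as
    the range \<open>[0..<m]\<close> includes 0.\<close>
  define petals where "petals = map (\<lambda>i. map (Pair i) [1..<m]) [1..<n]"
  define L where "L = map (Pair 0) [0..<m] @ concat petals"
  let ?T = "split_entry m n"
  have vs: "set vs = insert (0, 0) ({0..<n} \<times> {1..<m})"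
    using assms(1,2,4) by (simp add: verts_dutch_windmill)
  have setL: "set L = set vs"
    unfolding vs L_def petals_def using assms(1,2) by (auto simp: image_iff)
  have dp: "distinct (concat petals)"
    unfolding petals_def by (induction n) (auto simp: distinct_map inj_on_def)
  have dL: "distinct L" using dp by (auto simp: L_def petals_def distinct_map inj_on_def)
  have block: "char_poly (list_mat ?T (map (Pair i) [1..<m]) (map (Pair i) [1..<m])) = Lambda_poly (m - 1)"
    for i
  proof -
    \<comment> \<open>Without vertex 0 the wrap-around arcs disappear and the cycle becomes a
      path.\<close>
    have "list_mat (\<lambda>x y. ?T (i, x) (i, y)) [1..<m] [1..<m]
        = list_mat (\<lambda>x y. if y = Suc x \<or> x = Suc y then 1/2 else (0::real)) [1..<m] [1..<m]"
      using assms(1) by (intro list_mat_cong) (auto simp: split_entry_def cycle_entry_def cycle_arc_iff)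
    then show ?thesis using char_poly_path[of 1 "m - 1"] assms(1) by (simp add: list_mat_map)
  qed
  have "randic_poly (with_proj (dutch_windmill m n)) vs = char_poly (list_mat ?T L L)"
    unfolding randic_poly_def randic_matrix_windmill[OF assms(1,2) assms(4)[unfolded with_proj_simps]]
    by (rule char_poly_windmill_split[OF assms(1-3) dL vs setL])
  also have "\<dots> = char_poly (list_mat ?T (map (Pair 0) [0..<m]) (map (Pair 0) [0..<m]))
      * char_poly (list_mat ?T (concat petals) (concat petals))"
    unfolding L_def
    by (rule char_poly_list_mat_append[OF dL[unfolded L_def]]) (auto simp: petals_def split_entry_def)
  also have "char_poly (list_mat ?T (concat petals) (concat petals)) = Lambda_poly (m - 1) ^ (n - 1)"
  proof -
    \<comment> \<open>Entries between distinct petals vanish, since only the hub row of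
      \<open>?T\<close> is nonzero across different first coordinates.\<close>
    have "sorted_wrt (\<lambda>xs ys. \<forall>x\<in>set xs. \<forall>y\<in>set ys. ?T y x = 0) petals"
      unfolding petals_def sorted_wrt_map
      by (rule sorted_wrt_mono_rel[OF _ sorted_wrt_upt]) (auto simp: split_entry_def)
    from char_poly_list_mat_concat[OF dp this] show ?thesis
      by (simp only: petals_def map_map o_def block map_replicate_const prod_list_replicate length_upt)
  qed
  also have "char_poly (list_mat ?T (map (Pair 0) [0..<m]) (map (Pair 0) [0..<m]))
      = char_poly (list_mat (cycle_entry m) [0..<m] [0..<m])"
    by (simp add: list_mat_map split_entry_def)
  also have "\<dots> = char_poly (list_mat (cycle_entry m) ws ws)"
    using assms by (intro char_poly_list_mat_reorder) (auto simp: cycle_graph_def)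
  also have "\<dots> = randic_poly (with_proj (cycle_graph m)) ws"
    unfolding randic_poly_def using assms by (simp add: randic_matrix_cycle)
  finally show ?thesis by (simp add: mult.commute)
qed

end
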